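(* Let $\varphi=(1+\sqrt5)/2$. The equation $$\frac{u-1}{u}\left(\frac{u+1}{u}\right)^2=1$$ (equality of the relative Bures and covariance Fisher cometric determinants at an isotropic one-mode Gaussian state) has the unique solution $u=\varphi$ in $u>1$. At $u=\varphi$: (i) the Bures radial-to-traceless squared-cost ratio is $R_{\rm B}(\varphi)=\varphi^3$; (ii) the unweighted Frobenius quotient ratio is $R_{\rm Frob}(\varphi)=2\varphi+3\neq\varphi^3$; (iii) for constants $\alpha,\beta,\gamma>0$, the two-weight quotient ratio $G_0^{(\alpha,\beta)}/G_2^{(\alpha,\beta)}$ at $u=\varphi$ equals $R_{\rm B}(\varphi)$ if and only if $\beta/\alpha=\varphi^{-1}$.
   Context: Let $\hbar>0$, $\nu>\hbar/2$, $u=(2\nu/\hbar)^2>1$, $\Omega=\begin{pmatrix}0&1\\-1&0\end{pmatrix}$, $Z=\begin{pmatrix}1&0\\0&-1\end{pmatrix}$, $\kappa_\nu=\sqrt{\nu^2-\hbar^2/4}$. At the covariance $\nu\mathbb I_2$, relative to the classical covariance Fisher tensor, the Bures cometric on real symmetric $2\times2$ matrices has eigenvalue $(u-1)/u$ on multiples of $\mathbb I_2$ and $(u+1)/u$ on the two-dimensional space of traceless matrices; the Bures radial-to-traceless squared-cost ratio is $R_{\rm B}(u)=\frac{u+1}{u-1}$. The canonical purification of $\nu\mathbb I_2$ has covariance $\Gamma_\nu=\begin{pmatrix}\nu\mathbb I_2&\kappa_\nu Z\\ \kappa_\nu Z&\nu\mathbb I_2\end{pmatrix}$. With symplectic form $\Omega\oplus\Omega$,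 every $K\in\mathfrak{sp}(4,\mathbb R)$ has the block form $K=\begin{pmatrix}A&B\\ \Omega B^{\mathsf T}\Omega&D\end{pmatrix}$ with $A,D$ real traceless $2\times2$ and $B\in\mathbb R^{2\times2}$ arbitrary. $K$ induces the reduced tangent $X$ if $X=\nu(A+A^{\mathsf T})+\kappa_\nu(BZ+ZB^{\mathsf T})$ (the system block of $K\Gamma_\nu+\Gamma_\nu K^{\mathsf T}$). For $\alpha,\beta,\gamma>0$, $G_0^{(\alpha,\beta)}$ and $G_2^{(\alpha,\beta)}$ denote the minima of $\tfrac14[\alpha\operatorname{Tr}(A^{\mathsf T}A)+2\beta\operatorname{Tr}(B^{\mathsf T}B)+\gamma\operatorname{Tr}(D^{\mathsf T}D)]$ over all $K$ inducing the reduced tangent $\mathbb I_2$, respectively $Z$. The unweighted Frobenius ratio $R_{\rm Frob}(u)$ is $G_0^{(\alpha,\beta)}/G_2^{(\alpha,\beta)}$ for $\alpha=\beta=\gamma=1$, i.e. for the cost $\tfrac14\operatorname{Tr}(K^{\mathsf T}K)$. *)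

theory Defs
  imports "HOL-Analysis.Analysis"
begin

type_synonym mat2 = "real^2^2"
type_synonym mat4 = "real^(2 + 2)^(2 + 2)"

definition golden :: real where
  "golden = (1 + sqrt 5) / 2"

definition Omega :: mat2 where
  "Omega = vector [vector [0, 1], vector [-1, 0]]"

definition Zmat :: mat2 where
  "Zmat = vector [vector [1, 0], vector [0, -1]]"

definition Xmat :: mat2 where
  "Xmat = vector [vector [0, 1], vector [1, 0]]"

definition sym_mats :: "mat2 set" where
  "sym_mats = {P. transpose P = P}"

definition upar :: "real \<Rightarrow> real \<Rightarrow> real" where
  "upar hbar \<nu> = (2 * \<nu> / hbar)^2"

definition kappa :: "real \<Rightarrow> real \<Rightarrow> real" where
  "kappa hbar \<nu> = sqrt (\<nu>^2 - hbar^2 / 4)"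


subsection \<open>Fisher and Bures cometrics on covectors at a one-mode covariance\<close>

text \<open>
  Both cometrics are given up to the same positive constant, which cancels in all
  relative quantities. For a centred Gaussian state with covariance \<open>\<Sigma>\<close> the symmetric
  logarithmic derivative is quadratic with symmetric coefficient matrix \<open>P\<close>, and the tangent
  dual to \<open>P\<close> is proportional to \<open>\<Sigma> P \<Sigma> + (hbar\<^sup>2/4) \<Omega> P \<Omega>\<close>; the second term is absent
  classically.
\<close>

definition fisher_cometric :: "mat2 \<Rightarrow> mat2 \<Rightarrow> mat2 \<Rightarrow> real" where
  "fisher_cometric \<Sigma> P Q = trace (\<Sigma> ** P ** \<Sigma> ** Q)"

definition bures_cometric :: "real \<Rightarrow> mat2 \<Rightarrow> mat2 \<Rightarrow> mat2 \<Rightarrow> real" where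
  "bures_cometric hbar \<Sigma> P Q =
     trace (\<Sigma> ** P ** \<Sigma> ** Q) + hbar^2 / 4 * trace (Omega ** P ** Omega ** Q)"

text \<open>
  Gram determinant in the basis \<open>\<one>, Z, X\<close> of the symmetric matrices; a quotient of two such
  determinants does not depend on the basis.
\<close>

definition sym_basis :: "mat2^3" where
  "sym_basis = vector [mat 1, Zmat, Xmat]"

definition cometric_det :: "(mat2 \<Rightarrow> mat2 \<Rightarrow> real) \<Rightarrow> real" where
  "cometric_det g = det (\<chi> i j. g (sym_basis $ i) (sym_basis $ j))"

text \<open>Squared length of a tangent \<open>X\<close> in the metric inverse to the cometric \<open>g\<close>.\<close>

definition squared_cost :: "(mat2 \<Rightarrow> mat2 \<Rightarrow> real) \<Rightarrow> mat2 \<Rightarrow> real" where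
  "squared_cost g X =
     (THE c. \<exists>P\<in>sym_mats. (\<forall>Q\<in>sym_mats. g P Q = trace (Q ** X)) \<and> c = g P P)"

definition R_B :: "real \<Rightarrow> real" where
  "R_B u = (u + 1) / (u - 1)"


subsection \<open>Purification and quotient costs\<close>

definition block :: "mat2 \<Rightarrow> mat2 \<Rightarrow> mat2 \<Rightarrow> mat2 \<Rightarrow> mat4" where
  "block A B C D = (\<chi> i j.
     case i of
       Inl a \<Rightarrow> (case j of Inl b \<Rightarrow> A $ a $ b | Inr b \<Rightarrow> B $ a $ b)
     | Inr a \<Rightarrow> (case j of Inl b \<Rightarrow> C $ a $ b | Inr b \<Rightarrow> D $ a $ b))"

definition blockA :: "mat4 \<Rightarrow> mat2" where
  "blockA K = (\<chi> a b. K $ Inl a $ Inl b)"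

definition blockB :: "mat4 \<Rightarrow> mat2" where
  "blockB K = (\<chi> a b. K $ Inl a $ Inr b)"

definition blockD :: "mat4 \<Rightarrow> mat2" where
  "blockD K = (\<chi> a b. K $ Inr a $ Inr b)"

text \<open>
  The index type \<open>2 + 2\<close> makes \<open>Inl\<close> the system and \<open>Inr\<close> the purifying mode. The Lie algebra
  below is that of the group \<open>S J S\<^sup>T = J\<close>, \<open>J = \<Omega> \<oplus> \<Omega>\<close>, acting on covariances by \<open>S \<Gamma> S\<^sup>T\<close>;
  it coincides with the one of \<open>S\<^sup>T J S = J\<close>.
\<close>

definition sp4 :: "mat4 set" where
  "sp4 = {K. K ** block Omega 0 0 Omega + block Omega 0 0 Omega ** transpose K = 0}"

definition Gamma_cov :: "real \<Rightarrow> real \<Rightarrow> mat4" where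
  "Gamma_cov hbar \<nu> =
     block (mat \<nu>) (kappa hbar \<nu> *\<^sub>R Zmat) (kappa hbar \<nu> *\<^sub>R Zmat) (mat \<nu>)"

definition induces :: "real \<Rightarrow> real \<Rightarrow> mat4 \<Rightarrow> mat2 \<Rightarrow> bool" where
  "induces hbar \<nu> K X \<longleftrightarrow>
     X = blockA (K ** Gamma_cov hbar \<nu> + Gamma_cov hbar \<nu> ** transpose K)"

definition gen_cost :: "real \<Rightarrow> real \<Rightarrow> real \<Rightarrow> mat4 \<Rightarrow> real" where
  "gen_cost \<alpha> \<beta> \<gamma> K = 1 / 4 *
     (\<alpha> * trace (transpose (blockA K) ** blockA K)
      + 2 * \<beta> * trace (transpose (blockB K) ** blockB K)
      + \<gamma> * trace (transpose (blockD K) ** blockD K))"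

text \<open>\<open>LEAST\<close> denotes an attained minimum, not merely an infimum.\<close>

definition quotient_cost ::
    "real \<Rightarrow> real \<Rightarrow> real \<Rightarrow> real \<Rightarrow> real \<Rightarrow> mat2 \<Rightarrow> real" where
  "quotient_cost hbar \<nu> \<alpha> \<beta> \<gamma> X =
     (LEAST c. \<exists>K\<in>sp4. induces hbar \<nu> K X \<and> c = gen_cost \<alpha> \<beta> \<gamma> K)"

definition G0 :: "real \<Rightarrow> real \<Rightarrow> real \<Rightarrow> real \<Rightarrow> real \<Rightarrow> real" where
  "G0 hbar \<nu> \<alpha> \<beta> \<gamma> = quotient_cost hbar \<nu> \<alpha> \<beta> \<gamma> (mat 1)"

definition G2 :: "real \<Rightarrow> real \<Rightarrow> real \<Rightarrow> real \<Rightarrow> real \<Rightarrow> real" where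
  "G2 hbar \<nu> \<alpha> \<beta> \<gamma> = quotient_cost hbar \<nu> \<alpha> \<beta> \<gamma> Zmat"

definition R_Frob :: "real \<Rightarrow> real \<Rightarrow> real" where
  "R_Frob hbar \<nu> = G0 hbar \<nu> 1 1 1 / G2 hbar \<nu> 1 1 1"


subsection \<open>Agreement with the explicit block and eigenvalue formulas\<close>

lemma mat2_entries [simp]:
  "Omega $ 1 $ 1 = 0" "Omega $ 1 $ 2 = 1" "Omega $ 2 $ 1 = -1" "Omega $ 2 $ 2 = 0"
  "Zmat $ 1 $ 1 = 1" "Zmat $ 1 $ 2 = 0" "Zmat $ 2 $ 1 = 0" "Zmat $ 2 $ 2 = -1"
  "Xmat $ 1 $ 1 = 0" "Xmat $ 1 $ 2 = 1" "Xmat $ 2 $ 1 = 1" "Xmat $ 2 $ 2 = 0"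
  by (simp_all add: Omega_def Zmat_def Xmat_def)

lemma mat2_mult_nth: "(A ** B) $ i $ j = A $ i $ 1 * B $ 1 $ j + A $ i $ 2 * B $ 2 $ j"
  for A B :: mat2
  by (simp add: matrix_matrix_mult_def sum_2)

lemma mat2_trace: "trace A = A $ 1 $ 1 + A $ 2 $ 2" for A :: mat2
  by (simp add: trace_def sum_2)

lemma mat2_transpose_nth: "transpose A $ i $ j = A $ j $ i" for A :: mat2
  by (simp add: transpose_def)

lemma mat2_mat_nth: "(mat c :: mat2) $ i $ j = (if i = j then c else 0)"
  by (simp add: mat_def)

lemma mat2_eq_iff:
  "A = B \<longleftrightarrow> A $ 1 $ 1 = B $ 1 $ 1 \<and> A $ 1 $ 2 = B $ 1 $ 2
     \<and> A $ 2 $ 1 = B $ 2 $ 1 \<and> A $ 2 $ 2 = B $ 2 $ 2" for A B :: mat2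
  by (auto simp: vec_eq_iff forall_2)

lemmas mat2_simps = mat2_eq_iff mat2_mult_nth mat2_trace mat2_transpose_nth mat2_mat_nth

lemma all_sum2: "(\<forall>i::2 + 2. P i) \<longleftrightarrow> (\<forall>a. P (Inl a)) \<and> (\<forall>a. P (Inr a))"
  by (rule split_sum_all)

lemma sum_sum2: "(\<Sum>i\<in>(UNIV::(2 + 2) set). f i) = (\<Sum>a\<in>UNIV. f (Inl a)) + (\<Sum>a\<in>UNIV. f (Inr a))"
  for f :: "2 + 2 \<Rightarrow> real"
  unfolding UNIV_sum by (subst sum.union_disjoint) (auto simp: sum.reindex)

lemma upar_scaling:
  assumes "hbar > 0" "\<nu> > hbar / 2" "u = upar hbar \<nu>"
  shows "u > 1" "hbar^2 / 4 = \<nu>^2 * (1 / u)" "(u - 1) / u = 1 - 1 / u" "(u + 1) / u = 1 + 1 / u"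
proof -
  have "2 * \<nu> / hbar > 1" using assms by simp
  then show u: "u > 1" unfolding assms(3) upar_def by (rule one_less_power) simp
  have "\<nu> > 0" using assms by simp
  then show "hbar^2 / 4 = \<nu>^2 * (1 / u)"
    unfolding assms(3) upar_def using assms(1)
    by (simp add: power_divide power_mult_distrib)
  show "(u - 1) / u = 1 - 1 / u" "(u + 1) / u = 1 + 1 / u"
    using u by (simp_all add: diff_divide_distrib add_divide_distrib)
qed

lemma fisher_cometric_mat: "fisher_cometric (mat \<nu>) P Q = \<nu>^2 * trace (P ** Q)"
proof -
  have "mat \<nu> ** P ** mat \<nu> = \<nu>^2 *\<^sub>R P"
    by (simp add: mat2_simps power2_eq_square)
  then show ?thesis
    by (simp add: fisher_cometric_def scalar_matrix_assoc[symmetric] mat2_trace distrib_left)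
qed

lemma bures_cometric_mat:
  assumes "Omega ** P ** Omega = s *\<^sub>R P"
  shows "bures_cometric hbar (mat \<nu>) P Q = (\<nu>^2 + s * (hbar^2 / 4)) * trace (P ** Q)"
proof -
  have "trace (Omega ** P ** Omega ** Q) = s * trace (P ** Q)"
    by (simp add: assms scalar_matrix_assoc[symmetric] mat2_trace distrib_left)
  then have "bures_cometric hbar (mat \<nu>) P Q
      = \<nu>^2 * trace (P ** Q) + hbar^2 / 4 * (s * trace (P ** Q))"
    using fisher_cometric_mat[of \<nu> P Q] by (simp only: bures_cometric_def fisher_cometric_def)
  then show ?thesis by (simp add: distrib_right)
qed

lemma bures_radial:
  assumes "hbar > 0" "\<nu> > hbar / 2" "u = upar hbar \<nu>"
  shows "bures_cometric hbar (mat \<nu>) (mat c) Q = (u - 1) / u * fisher_cometric (mat \<nu>) (mat c) Q"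
proof -
  have "Omega ** mat c ** Omega = (-1) *\<^sub>R mat c"
    by (simp add: mat2_simps)
  then have "bures_cometric hbar (mat \<nu>) (mat c) Q
      = (\<nu>^2 + -1 * (\<nu>^2 * (1 / u))) * trace (mat c ** Q)"
    unfolding upar_scaling(2)[OF assms, symmetric] by (rule bures_cometric_mat)
  also have "\<dots> = (1 - 1 / u) * (\<nu>^2 * trace (mat c ** Q))"
    by (simp add: left_diff_distrib)
  finally show ?thesis
    unfolding fisher_cometric_mat upar_scaling(3)[OF assms] .
qed

lemma bures_traceless:
  assumes "hbar > 0" "\<nu> > hbar / 2" "u = upar hbar \<nu>" and P: "P \<in> sym_mats" "trace P = 0"
  shows "bures_cometric hbar (mat \<nu>) P Q = (u + 1) / u * fisher_cometric (mat \<nu>) P Q"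
proof -
  note upar = upar_scaling[OF assms(1-3)]
  have "transpose P $ 1 $ 2 = P $ 1 $ 2"
    using P(1) by (simp add: sym_mats_def)
  then have "P $ 2 $ 1 = P $ 1 $ 2"
    by (simp add: mat2_transpose_nth)
  moreover have "P $ 2 $ 2 = - P $ 1 $ 1"
    using P(2) by (simp add: mat2_trace eq_neg_iff_add_eq_0 add.commute)
  ultimately have "Omega ** P ** Omega = 1 *\<^sub>R P"
    by (simp add: mat2_simps)
  then have "bures_cometric hbar (mat \<nu>) P Q
      = (\<nu>^2 + 1 * (\<nu>^2 * (1 / u))) * trace (P ** Q)"
    unfolding upar(2)[symmetric] by (rule bures_cometric_mat)
  also have "\<dots> = (1 + 1 / u) * (\<nu>^2 * trace (P ** Q))"
    by (simp add: distrib_right)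
  finally show ?thesis
    unfolding fisher_cometric_mat upar(4) .
qed

lemma blocks_block [simp]:
  "blockA (block A B C D) = A" "blockB (block A B C D) = B" "blockD (block A B C D) = D"
  by (simp_all add: blockA_def blockB_def blockD_def block_def vec_eq_iff)

lemma block_exhaust: "\<exists>C. K = block (blockA K) (blockB K) C (blockD K)"
  by (rule exI[of _ "\<chi> a b. K $ Inr a $ Inl b"])
    (simp add: vec_eq_iff all_sum2 block_def blockA_def blockB_def blockD_def)

lemma block_eq_iff [simp]:
  "block A B C D = block A' B' C' D' \<longleftrightarrow> A = A' \<and> B = B' \<and> C = C' \<and> D = D'"
  by (auto simp add: vec_eq_iff all_sum2 block_def)

lemma block_zero: "0 = block 0 0 0 0"
  by (simp add: vec_eq_iff all_sum2 block_def)

lemma block_add: "block A B C D + block A' B' C' D' = block (A + A') (B + B') (C + C') (D + D')"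
  by (simp add: vec_eq_iff all_sum2 block_def)

lemma block_mult: "block A B C D ** block A' B' C' D' =
    block (A ** A' + B ** C') (A ** B' + B ** D') (C ** A' + D ** C') (C ** B' + D ** D')"
  by (simp add: vec_eq_iff all_sum2 sum_sum2 block_def matrix_matrix_mult_def)

lemma block_transpose:
  "transpose (block A B C D) = block (transpose A) (transpose C) (transpose B) (transpose D)"
  by (simp add: vec_eq_iff all_sum2 block_def transpose_def)

lemma block_trace: "trace (block A B C D) = trace A + trace D"
  by (simp add: sum_sum2 block_def trace_def)

lemma block_in_sp4:
  "block A B C D \<in> sp4 \<longleftrightarrow> trace A = 0 \<and> trace D = 0 \<and> C = Omega ** transpose B ** Omega"
proof -
  have zero: "M ** 0 = 0" "0 ** M = 0" for M :: mat2
    by (simp_all add: mat2_simps)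
  have "block A B C D \<in> sp4 \<longleftrightarrow>
      A ** Omega + Omega ** transpose A = 0 \<and> B ** Omega + Omega ** transpose C = 0 \<and>
      C ** Omega + Omega ** transpose B = 0 \<and> D ** Omega + Omega ** transpose D = 0"
    by (simp add: sp4_def block_mult block_transpose block_add block_zero zero)
  also have "\<dots> \<longleftrightarrow> trace A = 0 \<and> trace D = 0 \<and> C = Omega ** transpose B ** Omega"
    by (simp add: mat2_simps) argo
  finally show ?thesis .
qed

lemma sp4_iff:
  "K \<in> sp4 \<longleftrightarrow> (\<exists>A B D. trace A = 0 \<and> trace D = 0 \<and>
     K = block A B (Omega ** transpose B ** Omega) D)"
  by (metis block_exhaust block_in_sp4)

lemma induces_iff:
  "induces hbar \<nu> K X \<longleftrightarrow>
     X = \<nu> *\<^sub>R (blockA K + transpose (blockA K))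
       + kappa hbar \<nu> *\<^sub>R (blockB K ** Zmat + Zmat ** transpose (blockB K))"
proof -
  obtain A B C D where K: "K = block A B C D"
    using block_exhaust by blast
  have "A ** mat \<nu> + B ** (k *\<^sub>R Zmat) + (mat \<nu> ** transpose A + (k *\<^sub>R Zmat) ** transpose B)
      = \<nu> *\<^sub>R (A + transpose A) + k *\<^sub>R (B ** Zmat + Zmat ** transpose B)" for k
    by (simp add: mat2_simps algebra_simps)
  then show ?thesis
    by (simp add: induces_def K Gamma_cov_def block_mult block_transpose block_add)
qed

lemma gen_cost_unweighted:
  assumes "K \<in> sp4"
  shows "gen_cost 1 1 1 K = 1 / 4 * trace (transpose K ** K)"
proof -
  obtain A B D where K: "K = block A B (Omega ** transpose B ** Omega) D"
    using assms sp4_iff by blast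
  show ?thesis
    by (simp add: K gen_cost_def block_mult block_transpose block_trace mat2_simps)
qed

end

theory Submission
  imports Defs
begin

text \<open>
  The radial and the traceless directions decouple. The identity can only be reached through the
  off-diagonal block, so its quotient cost is \<open>\<beta> / (4 \<kappa>\<^sup>2)\<close>; for \<open>Z\<close> one minimises
  \<open>2 \<alpha> a\<^sup>2 + 4 \<beta> p\<^sup>2\<close> on the line \<open>\<nu> a + \<kappa> p = 1/2\<close>. Hence the quotient ratio is
  \<open>1 + 2 (\<beta>/\<alpha>) u / (u - 1)\<close>, in which \<open>u / (u - 1) = \<phi>\<^sup>2\<close> at \<open>u = \<phi>\<close>.
\<close>

section \<open>The golden ratio and the determinant equation\<close>

lemma golden_gt_1: "golden > 1"
  by (simp add: golden_def)

lemma golden_square: "golden^2 = golden + 1"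
  by (simp add: golden_def power2_eq_square field_simps)

lemma golden_cube: "golden^3 = 2 * golden + 1"
  using golden_square by (simp add: power3_eq_cube power2_eq_square) algebra

lemma determinant_equation_iff:
  assumes "u > 1"
  shows "(u - 1) / u * ((u + 1) / u)^2 = 1 \<longleftrightarrow> u = golden"
proof -
  have "(u - 1) / u * ((u + 1) / u)^2 = ((u - 1) * (u + 1)^2) / u^3"
    by (simp add: power_divide power2_eq_square power3_eq_cube)
  moreover have "u^3 \<noteq> 0"
    using assms by simp
  ultimately have "(u - 1) / u * ((u + 1) / u)^2 = 1 \<longleftrightarrow> (u - 1) * (u + 1)^2 = u^3"
    by (metis divide_eq_1_iff)
  \<comment> \<open>The cubic terms cancel:
    \<open>(u - 1) * (u + 1)^2 = u^3 + u^2 - u - 1\<close>.\<close>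
  also have "\<dots> \<longleftrightarrow> u^2 = u + 1"
    by algebra
  \<comment> \<open>The conjugate root \<open>1 - golden\<close> is negative, so
    \<open>u > 1\<close> excludes it.\<close>
  also have "\<dots> \<longleftrightarrow> (u - golden) * (u + golden - 1) = 0"
    using golden_square by algebra
  also have "\<dots> \<longleftrightarrow> u = golden"
    using assms golden_gt_1 by simp
  finally show ?thesis .
qed

lemma R_B_golden: "R_B golden = golden^3"
proof -
  \<comment> \<open>Both sides equal \<open>golden^2\<close>, because
    \<open>golden * (golden - 1) = 1\<close>.\<close>
  have "golden + 1 = golden^3 * (golden - 1)"
    using golden_square by algebra
  then show ?thesis
    using golden_gt_1 by (simp add: R_B_def)
qed

section \<open>Cometric determinants\<close>

lemma cometric_det_fisher_mat: "cometric_det (fisher_cometric (mat \<nu>)) = 8 * \<nu>^6"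
  by (simp add: cometric_det_def det_3 sym_basis_def fisher_cometric_mat mat2_simps)

text \<open>The basis is orthogonal for the trace form, so both Gram matrices are diagonal. Passing
  from Fisher to Bures multiplies the one radial entry by \<open>(u - 1) / u\<close> and each of the
  two traceless entries by \<open>(u + 1) / u\<close>.\<close>

lemma cometric_det_bures_mat:
  assumes "hbar > 0" "\<nu> > hbar / 2" "u = upar hbar \<nu>"
  shows "cometric_det (bures_cometric hbar (mat \<nu>)) = 8 * \<nu>^6 * ((u - 1) / u * ((u + 1) / u)^2)"
proof -
  have "Zmat \<in> sym_mats" "trace Zmat = 0" "Xmat \<in> sym_mats" "trace Xmat = 0"
    by (simp_all add: sym_mats_def mat2_simps)
  then show ?thesis
    by (simp add: cometric_det_def det_3 sym_basis_def bures_radial[OF assms]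
        bures_traceless[OF assms] fisher_cometric_mat mat2_simps)
      (simp add: eval_nat_numeral ac_simps)
qed

section \<open>Squared costs in the Bures metric\<close>

lemma bures_cometric_mat_commute:
  "bures_cometric hbar (mat \<nu>) P Q = bures_cometric hbar (mat \<nu>) Q P"
  by (simp add: bures_cometric_def mat2_simps algebra_simps)

text \<open>Two covectors \<open>P\<close> and \<open>P'\<close> dual to \<open>X\<close> give the
  same cost: evaluating \<open>g P P'\<close> with either one as the representing covector yields
  \<open>trace (P' ** X) = trace (P ** X)\<close>. Symmetry of \<open>g\<close> thus makes the cost
  well defined without uniqueness of the covector.\<close>

lemma squared_cost_eq:
  assumes sym: "\<And>P Q. g P Q = g Q P"
    and P: "P \<in> sym_mats" "\<And>Q. Q \<in> sym_mats \<Longrightarrow> g P Q = trace (Q ** X)"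
  shows "squared_cost g X = trace (P ** X)"
  unfolding squared_cost_def
proof (rule the_equality)
  show "\<exists>P'\<in>sym_mats. (\<forall>Q\<in>sym_mats. g P' Q = trace (Q ** X)) \<and> trace (P ** X) = g P' P'"
    using P by (intro bexI[of _ P]) auto
next
  fix c
  assume "\<exists>P'\<in>sym_mats. (\<forall>Q\<in>sym_mats. g P' Q = trace (Q ** X)) \<and> c = g P' P'"
  then obtain P' where "P' \<in> sym_mats" "\<And>Q. Q \<in> sym_mats \<Longrightarrow> g P' Q = trace (Q ** X)" "c = g P' P'"
    by blast
  then show "c = trace (P ** X)"
    using P sym by metis
qed

lemma squared_cost_bures_eigenvector:
  assumes X: "X \<in> sym_mats" and "l \<noteq> 0"
    and eig: "\<And>Q. bures_cometric hbar (mat \<nu>) X Q = l * trace (X ** Q)"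
  shows "squared_cost (bures_cometric hbar (mat \<nu>)) X = trace (X ** X) / l"
proof -
  \<comment> \<open>Dividing an eigenvector by its eigenvalue gives its dual covector.\<close>
  define P where "P = (1 / l) *\<^sub>R X"
  have "bures_cometric hbar (mat \<nu>) P Q = (1 / l) * bures_cometric hbar (mat \<nu>) X Q" for Q
    by (simp add: P_def bures_cometric_def mat2_simps algebra_simps)
  then have "bures_cometric hbar (mat \<nu>) P Q = trace (Q ** X)" for Q
    using \<open>l \<noteq> 0\<close> eig by (simp add: mat2_simps algebra_simps)
  moreover have "P \<in> sym_mats"
    using X by (simp add: P_def sym_mats_def transpose_scalar)
  ultimately have "squared_cost (bures_cometric hbar (mat \<nu>)) X = trace (P ** X)"
    by (intro squared_cost_eq bures_cometric_mat_commute)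
  then show ?thesis
    by (simp add: P_def mat2_simps add_divide_distrib)
qed

text \<open>Since \<open>mat 1\<close> and \<open>Zmat\<close> have the same trace norm, the cost
  ratio is the inverse ratio of the cometric eigenvalues. This ties the closed form
  \<open>R_B\<close> to the metric itself.\<close>

lemma squared_cost_bures_ratio:
  assumes "hbar > 0" "\<nu> > hbar / 2" "u = upar hbar \<nu>"
  shows "squared_cost (bures_cometric hbar (mat \<nu>)) (mat 1)
    / squared_cost (bures_cometric hbar (mat \<nu>)) Zmat = R_B u"
proof -
  note u = upar_scaling(1)[OF assms]
  have \<nu>: "\<nu> > 0"
    using assms by simp
  have Z: "Zmat \<in> sym_mats" "trace Zmat = 0"
    by (simp_all add: sym_mats_def mat2_simps)
  have "squared_cost (bures_cometric hbar (mat \<nu>)) (mat 1)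
      = trace (mat 1 ** mat 1 :: mat2) / ((u - 1) / u * \<nu>^2)"
    using u \<nu> by (intro squared_cost_bures_eigenvector)
      (auto simp: bures_radial[OF assms] fisher_cometric_mat sym_mats_def mat2_simps)
  moreover have "squared_cost (bures_cometric hbar (mat \<nu>)) Zmat
      = trace (Zmat ** Zmat) / ((u + 1) / u * \<nu>^2)"
    using u \<nu> Z by (intro squared_cost_bures_eigenvector)
      (auto simp: bures_traceless[OF assms] fisher_cometric_mat)
  ultimately show ?thesis
    using u \<nu> by (simp add: R_B_def mat2_simps)
qed

section \<open>Minimal quotient costs\<close>

lemma quotient_cost_eqI:
  assumes "trace A = 0"
    and "X = \<nu> *\<^sub>R (A + transpose A) + kappa hbar \<nu> *\<^sub>R (B ** Zmat + Zmat ** transpose B)"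
    and c: "c = 1 / 4 * (\<alpha> * trace (transpose A ** A) + 2 * \<beta> * trace (transpose B ** B))"
    and "\<gamma> > 0"
    and lower: "\<And>A B. trace A = 0 \<Longrightarrow>
      X = \<nu> *\<^sub>R (A + transpose A) + kappa hbar \<nu> *\<^sub>R (B ** Zmat + Zmat ** transpose B) \<Longrightarrow>
      c \<le> 1 / 4 * (\<alpha> * trace (transpose A ** A) + 2 * \<beta> * trace (transpose B ** B))"
  shows "quotient_cost hbar \<nu> \<alpha> \<beta> \<gamma> X = c"
  unfolding quotient_cost_def
proof (rule Least_equality)
  show "\<exists>K\<in>sp4. induces hbar \<nu> K X \<and> c = gen_cost \<alpha> \<beta> \<gamma> K"
  proof (intro bexI conjI)
    \<comment> \<open>The constraint leaves \<open>D\<close> free and its cost is nonnegative, so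
      \<open>D = 0\<close> is optimal and only \<open>A\<close> and \<open>B\<close> remain to be
      minimised over.\<close>
    show "block A B (Omega ** transpose B ** Omega) 0 \<in> sp4"
      using assms(1) by (simp add: block_in_sp4 mat2_trace)
  qed (use assms(2) c in \<open>simp_all add: induces_iff gen_cost_def mat2_simps\<close>)
next
  fix y
  assume "\<exists>K\<in>sp4. induces hbar \<nu> K X \<and> y = gen_cost \<alpha> \<beta> \<gamma> K"
  then obtain K where K: "K \<in> sp4" "induces hbar \<nu> K X" "y = gen_cost \<alpha> \<beta> \<gamma> K"
    by blast
  obtain A B D where A: "trace A = 0" and block: "K = block A B (Omega ** transpose B ** Omega) D"
    using K(1) sp4_iff by blast
  have X: "X = \<nu> *\<^sub>R (A + transpose A) + kappa hbar \<nu> *\<^sub>R (B ** Zmat + Zmat ** transpose B)"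
    using K(2) by (simp add: induces_iff block)
  have y: "y = 1 / 4 * (\<alpha> * trace (transpose A ** A) + 2 * \<beta> * trace (transpose B ** B)
      + \<gamma> * trace (transpose D ** D))"
    using K(3) by (simp add: gen_cost_def block)
  have "c \<le> 1 / 4 * (\<alpha> * trace (transpose A ** A) + 2 * \<beta> * trace (transpose B ** B))"
    using A X by (rule lower)
  moreover have "\<gamma> * trace (transpose D ** D) \<ge> 0"
    using \<open>\<gamma> > 0\<close> by (simp add: mat2_simps)
  ultimately show "c \<le> y"
    unfolding y by argo
qed

lemma G0_eq:
  assumes "\<alpha> > 0" "\<beta> > 0" "\<gamma> > 0" and k: "kappa hbar \<nu> > 0"
  shows "G0 hbar \<nu> \<alpha> \<beta> \<gamma> = \<beta> / (4 * (kappa hbar \<nu>)^2)"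
  unfolding G0_def
proof (rule quotient_cost_eqI)
  define k where "k = kappa hbar \<nu>"
  have "k > 0"
    using k by (simp add: k_def)
  show "trace (0 :: mat2) = 0"
    by (simp add: mat2_trace)
  \<comment> \<open>This choice of \<open>B\<close> is the equality case \<open>s = - p\<close> of
    the bound on \<open>(p - s)^2\<close> below.\<close>
  show "mat 1 = \<nu> *\<^sub>R (0 + transpose 0)
      + kappa hbar \<nu> *\<^sub>R ((1 / (2 * kappa hbar \<nu>)) *\<^sub>R Zmat ** Zmat
        + Zmat ** transpose ((1 / (2 * kappa hbar \<nu>)) *\<^sub>R Zmat))"
    using k by (simp add: mat2_simps)
  show "\<beta> / (4 * (kappa hbar \<nu>)^2) = 1 / 4 * (\<alpha> * trace (transpose (0 :: mat2) ** 0) + 2 * \<beta> *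
     trace (transpose ((1 / (2 * kappa hbar \<nu>)) *\<^sub>R Zmat) ** (1 / (2 * kappa hbar \<nu>)) *\<^sub>R Zmat))"
    using k by (simp add: mat2_simps power2_eq_square field_simps)
  fix A B :: mat2
  assume "trace A = 0" and X: "mat 1 = \<nu> *\<^sub>R (A + transpose A)
    + kappa hbar \<nu> *\<^sub>R (B ** Zmat + Zmat ** transpose B)"
  define p s where "p = B $ 1 $ 1" and "s = B $ 2 $ 2"
  have "A $ 2 $ 2 = - A $ 1 $ 1"
    using \<open>trace A = 0\<close> by (simp add: mat2_trace eq_neg_iff_add_eq_0 add.commute)
  then have "2 * \<nu> * A $ 1 $ 1 + 2 * k * p = 1" "- 2 * \<nu> * A $ 1 $ 1 - 2 * k * s = 1"
    using X by (simp_all add: mat2_simps p_def s_def k_def)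
  \<comment> \<open>Adding the two diagonal equations takes the trace of the constraint, which
    eliminates the traceless \<open>A\<close>.\<close>
  then have "k * (p - s) = 1"
    by (simp add: algebra_simps)
  then have "1 / k = p - s"
    using \<open>k > 0\<close> by (simp add: field_simps)
  then have "1 / k^2 = (p - s)^2"
    by (metis power_one_over)
  also have "\<dots> \<le> 2 * (p^2 + s^2)"
    using zero_le_power2[of "p + s"] by (simp add: power2_sum power2_diff)
  also have "\<dots> \<le> 2 * trace (transpose B ** B)"
    by (simp add: mat2_simps p_def s_def power2_eq_square)
  finally have "\<beta> * (1 / k^2) \<le> \<beta> * (2 * trace (transpose B ** B))"
    using \<open>\<beta> > 0\<close> by (intro mult_left_mono) simp_all
  moreover have "\<alpha> * trace (transpose A ** A) \<ge> 0"
    using \<open>\<alpha> > 0\<close> by (simp add: mat2_simps)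
  ultimately show "\<beta> / (4 * (kappa hbar \<nu>)^2)
      \<le> 1 / 4 * (\<alpha> * trace (transpose A ** A) + 2 * \<beta> * trace (transpose B ** B))"
    by (simp add: k_def)
qed (use assms in simp)

lemma G2_eq:
  assumes "\<alpha> > 0" "\<beta> > 0" "\<gamma> > 0" and k: "kappa hbar \<nu> > 0"
  shows "G2 hbar \<nu> \<alpha> \<beta> \<gamma> = \<alpha> * \<beta> / (4 * (2 * \<beta> * \<nu>^2 + \<alpha> * (kappa hbar \<nu>)^2))"
  unfolding G2_def
proof (rule quotient_cost_eqI)
  define k where "k = kappa hbar \<nu>"
  define m where "m = 2 * \<beta> * \<nu>^2 + \<alpha> * k^2"
  have "k > 0"
    using k by (simp add: k_def)
  then have m: "m > 0"
    unfolding m_def using assms by (intro add_nonneg_pos) simp_all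
  \<comment> \<open>The Lagrange condition makes \<open>a\<close> proportional to
    \<open>\<beta> * \<nu>\<close> and \<open>p\<close> to \<open>\<alpha> * k / 2\<close>; dividing
    by \<open>m\<close> puts the point on the line \<open>\<nu> * a + k * p = 1 / 2\<close>.\<close>
  define A0 B0 :: mat2 where "A0 = (\<beta> * \<nu> / m) *\<^sub>R Zmat" and "B0 = mat (\<alpha> * k / (2 * m))"
  show "trace A0 = 0"
    by (simp add: mat2_trace A0_def)
  show "Zmat = \<nu> *\<^sub>R (A0 + transpose A0) + kappa hbar \<nu> *\<^sub>R (B0 ** Zmat + Zmat ** transpose B0)"
    using m unfolding k_def[symmetric] A0_def B0_def
    by (simp add: mat2_simps field_simps) (simp add: m_def power2_eq_square algebra_simps)
  have "\<alpha> * trace (transpose A0 ** A0) + 2 * \<beta> * trace (transpose B0 ** B0)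
      = \<alpha> * \<beta> * m / m^2"
    unfolding m_def[symmetric] using m
    by (simp add: A0_def B0_def mat2_simps field_simps power2_eq_square)
       (simp add: m_def power2_eq_square algebra_simps)
  also have "\<dots> = \<alpha> * \<beta> / m"
    using m by (simp add: power2_eq_square)
  finally show "\<alpha> * \<beta> / (4 * (2 * \<beta> * \<nu>^2 + \<alpha> * (kappa hbar \<nu>)^2))
      = 1 / 4 * (\<alpha> * trace (transpose A0 ** A0) + 2 * \<beta> * trace (transpose B0 ** B0))"
    by (simp add: m_def k_def)
  fix A B :: mat2
  assume "trace A = 0" and X: "Zmat = \<nu> *\<^sub>R (A + transpose A)
    + kappa hbar \<nu> *\<^sub>R (B ** Zmat + Zmat ** transpose B)"
  define a p where "a = A $ 1 $ 1" and "p = B $ 1 $ 1"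
  have A22: "A $ 2 $ 2 = - a"
    using \<open>trace A = 0\<close> by (simp add: mat2_trace a_def eq_neg_iff_add_eq_0 add.commute)
  then have line: "2 * (\<nu> * a + k * p) = 1" and "2 * (\<nu> * a + k * B $ 2 $ 2) = 1"
    using X by (simp_all add: mat2_simps a_def p_def k_def algebra_simps)
  then have "k * B $ 2 $ 2 = k * p"
    by argo
  then have B22: "B $ 2 $ 2 = p"
    using \<open>k > 0\<close> by simp
  \<comment> \<open>Weighted Cauchy-Schwarz as an identity; the remainder square vanishes at the
    minimiser chosen above.\<close>
  have "(2 * \<alpha> * a^2 + 4 * \<beta> * p^2) * m
      = \<alpha> * \<beta> * (2 * (\<nu> * a + k * p))^2 + 2 * (\<alpha> * k * a - 2 * \<beta> * \<nu> * p)^2"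
    unfolding m_def by algebra
  then have "\<alpha> * \<beta> \<le> (2 * \<alpha> * a^2 + 4 * \<beta> * p^2) * m"
    unfolding line by simp
  then have "\<alpha> * \<beta> / m \<le> 2 * \<alpha> * a^2 + 4 * \<beta> * p^2"
    using m by (simp add: pos_divide_le_eq)
  \<comment> \<open>Off-diagonal entries of \<open>A\<close>, and below those of \<open>B\<close>,
    only add squares.\<close>
  moreover have "\<alpha> * (2 * a^2) \<le> \<alpha> * trace (transpose A ** A)"
    using \<open>\<alpha> > 0\<close> by (intro mult_left_mono) (simp_all add: mat2_simps A22 a_def power2_eq_square)
  moreover have "2 * \<beta> * (2 * p^2) \<le> 2 * \<beta> * trace (transpose B ** B)"
    using \<open>\<beta> > 0\<close> by (intro mult_left_mono) (simp_all add: mat2_simps B22 p_def power2_eq_square)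
  ultimately have "\<alpha> * \<beta> / m
      \<le> \<alpha> * trace (transpose A ** A) + 2 * \<beta> * trace (transpose B ** B)"
    by simp
  then show "\<alpha> * \<beta> / (4 * (2 * \<beta> * \<nu>^2 + \<alpha> * (kappa hbar \<nu>)^2))
      \<le> 1 / 4 * (\<alpha> * trace (transpose A ** A) + 2 * \<beta> * trace (transpose B ** B))"
    unfolding k_def[symmetric] m_def[symmetric] by simp
qed (use assms in simp)

section \<open>The quotient ratio and its value at the golden ratio\<close>

lemma quotient_ratio:
  assumes "hbar > 0" "\<nu> > hbar / 2" "u = upar hbar \<nu>" and pos: "\<alpha> > 0" "\<beta> > 0" "\<gamma> > 0"
  shows "G0 hbar \<nu> \<alpha> \<beta> \<gamma> / G2 hbar \<nu> \<alpha> \<beta> \<gamma> = 1 + 2 * (\<beta> / \<alpha>) * (u / (u - 1))"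
proof -
  note u = upar_scaling[OF assms(1-3)]
  have \<nu>: "\<nu> > 0"
    using assms by simp
  define k where "k = kappa hbar \<nu>"
  \<comment> \<open>The left side is the square of \<open>kappa\<close>, so \<open>hbar\<close> and
    \<open>\<nu>\<close> enter the ratio only through \<open>u\<close>.\<close>
  have \<nu>k: "\<nu>^2 - hbar^2 / 4 = \<nu>^2 * ((u - 1) / u)"
    unfolding u(2) using u(1) by (simp add: field_simps)
  moreover have "\<nu>^2 * ((u - 1) / u) > 0"
    using u(1) \<nu> by simp
  ultimately have k: "k > 0" "k^2 = \<nu>^2 * ((u - 1) / u)"
    by (simp_all add: k_def kappa_def)
  have "G0 hbar \<nu> \<alpha> \<beta> \<gamma> / G2 hbar \<nu> \<alpha> \<beta> \<gamma> = (2 * \<beta> * \<nu>^2 + \<alpha> * k^2) / (\<alpha> * k^2)"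
  proof -
    have "\<beta> / (4 * k^2) / (\<alpha> * \<beta> / (4 * m)) = m / (\<alpha> * k^2)" for m
      using pos by simp
    then show ?thesis
      using k(1) pos by (simp only: G0_eq G2_eq k_def[symmetric])
  qed
  also have "\<dots> = 1 + 2 * (\<beta> / \<alpha>) * (\<nu>^2 / k^2)"
    using k(1) pos by (simp add: add_divide_distrib)
  also have "\<nu>^2 / k^2 = u / (u - 1)"
    using \<nu> by (simp add: k(2))
  finally show ?thesis .
qed

lemma quotient_ratio_golden:
  assumes "hbar > 0" "\<nu> > hbar / 2" "upar hbar \<nu> = golden" "\<alpha> > 0" "\<beta> > 0" "\<gamma> > 0"
  shows "G0 hbar \<nu> \<alpha> \<beta> \<gamma> / G2 hbar \<nu> \<alpha> \<beta> \<gamma> = 1 + 2 * (\<beta> / \<alpha>) * golden^2"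
proof -
  have "golden = golden^2 * (golden - 1)"
    using golden_square by algebra
  then have "golden / (golden - 1) = golden^2"
    using golden_gt_1 by (simp add: divide_eq_eq)
  then show ?thesis
    using quotient_ratio[OF assms(1,2) assms(3)[symmetric] assms(4-6)] by simp
qed

theorem mainTheorem8:
  shows "(\<forall>u::real. u > 1 \<and> (u - 1) / u * ((u + 1) / u)^2 = 1 \<longleftrightarrow> u = golden)
    \<and> (\<forall>hbar \<nu> u. hbar > 0 \<and> \<nu> > hbar / 2 \<and> u = upar hbar \<nu> \<longrightarrow>
         (cometric_det (bures_cometric hbar (mat \<nu>)) = cometric_det (fisher_cometric (mat \<nu>))
           \<longleftrightarrow> (u - 1) / u * ((u + 1) / u)^2 = 1))
    \<and> R_B golden = golden^3
    \<and> 2 * golden + 3 \<noteq> golden^3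
    \<and> (\<forall>hbar \<nu>. hbar > 0 \<and> \<nu> > hbar / 2 \<and> upar hbar \<nu> = golden \<longrightarrow>
         squared_cost (bures_cometric hbar (mat \<nu>)) (mat 1)
           / squared_cost (bures_cometric hbar (mat \<nu>)) Zmat = R_B golden
       \<and> R_Frob hbar \<nu> = 2 * golden + 3
       \<and> (\<forall>\<alpha> \<beta> \<gamma>. \<alpha> > 0 \<and> \<beta> > 0 \<and> \<gamma> > 0 \<longrightarrow>
            (G0 hbar \<nu> \<alpha> \<beta> \<gamma> / G2 hbar \<nu> \<alpha> \<beta> \<gamma> = R_B golden \<longleftrightarrow> \<beta> / \<alpha> = inverse golden)))"
proof (intro conjI allI impI; (elim conjE)?)
  fix u :: real
  show "u > 1 \<and> (u - 1) / u * ((u + 1) / u)^2 = 1 \<longleftrightarrow> u = golden"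
    using determinant_equation_iff golden_gt_1 by metis
next
  fix hbar \<nu> u :: real
  assume *: "hbar > 0" "\<nu> > hbar / 2" "u = upar hbar \<nu>"
  then have "8 * \<nu>^6 \<noteq> 0"
    by simp
  then show "cometric_det (bures_cometric hbar (mat \<nu>)) = cometric_det (fisher_cometric (mat \<nu>))
      \<longleftrightarrow> (u - 1) / u * ((u + 1) / u)^2 = 1"
    unfolding cometric_det_bures_mat[OF *] cometric_det_fisher_mat by (metis mult_cancel_left1)
next
  show "R_B golden = golden^3"
    by (rule R_B_golden)
  \<comment> \<open>The cube reduces to \<open>2 * golden + 1\<close>, so the two sides differ by
    2.\<close>
  show "2 * golden + 3 \<noteq> golden^3"
    by (simp add: golden_cube)
next
  fix hbar \<nu> :: real
  assume *: "hbar > 0" "\<nu> > hbar / 2" "upar hbar \<nu> = golden"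
  show "squared_cost (bures_cometric hbar (mat \<nu>)) (mat 1)
      / squared_cost (bures_cometric hbar (mat \<nu>)) Zmat = R_B golden"
    using * squared_cost_bures_ratio by simp
  show "R_Frob hbar \<nu> = 2 * golden + 3"
    using quotient_ratio_golden[OF *, of 1 1 1] by (simp add: R_Frob_def golden_square)
  fix \<alpha> \<beta> \<gamma> :: real
  assume "\<alpha> > 0" "\<beta> > 0" "\<gamma> > 0"
  then have "G0 hbar \<nu> \<alpha> \<beta> \<gamma> / G2 hbar \<nu> \<alpha> \<beta> \<gamma> = R_B golden
      \<longleftrightarrow> 1 + 2 * (\<beta> / \<alpha>) * golden^2 = golden^3"
    unfolding R_B_golden using quotient_ratio_golden[OF *] by simp
  \<comment> \<open>The target is rewritten as the value of the affine map
    \<open>x \<mapsto> 1 + 2 * x * golden^2\<close> at \<open>inverse golden\<close>; injectivity of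
    that map gives both directions.\<close>
  also have "golden^3 = 1 + 2 * inverse golden * golden^2"
    using golden_gt_1 by (simp add: golden_cube power2_eq_square)
  also have "1 + 2 * x * golden^2 = 1 + 2 * y * golden^2 \<longleftrightarrow> x = y" for x y
    using golden_gt_1 by simp
  finally show "G0 hbar \<nu> \<alpha> \<beta> \<gamma> / G2 hbar \<nu> \<alpha> \<beta> \<gamma> = R_B golden \<longleftrightarrow> \<beta> / \<alpha> = inverse golden" .
qed

end
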